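(* Let $A$ be a simple selfadjoint operator in an infinite-dimensional separable Hilbert space $\mathcal{H}$ and let $\delta$ be a cyclic vector of $A$. The Gram-Schmidt procedure applied to the sequence $\{A^{k-1}\delta\}_{k=1}^{\infty}$ yields a basis of representation for $A$ if and only if $$\overline{\operatorname{span}}\,\{(A-iI)A^{k-1}\delta : k\in\mathbb{N}\}=\mathcal{H}.$$
   Context: Hilbert spaces are complex; inner products are antilinear in the first argument; $\mathbb{N}=\{1,2,\dots\}$. A generating element of a selfadjoint operator $A$ with spectral measure $E$ is a vector $g\in\mathcal{H}$ such that the span of $\{E(\partial)g:\partial\subset\mathbb{R}\text{ Borel}\}$ is dense in $\mathcal{H}$; $A$ is simple if it has a generating element. A vector $f$ is a cyclic vector of $A$ if $f\in\operatorname{dom}A^k$ for all $k\in\mathbb{N}$ and the span of $\{A^kf:k\ge0\}$ is dense in $\mathcal{H}$. Basis of representation: an orthonormal basis $\{u_k\}_{k=1}^\infty$ of $\mathcal{H}$ is a basis of representation for a closed operator $A$ if (a) $u_k\in\operatorname{dom}A$ for all $k$, and (b) every closed operator $B$ with $Bu_k=Au_k$ for all $k$ satisfies $B\supset A$. The Gram-Schmidt procedure applied to a linearly independent sequence $\{v_k\}_{k=1}^\infty$ yields the orthonormal sequence $\{\delta_k\}_{k=1}^\infty$ with $\operatorname{span}\{\delta_1,\dots,\delta_k\}=\operatorname{span}\{v_1,\dots,v_k\}$ and $\langle\delta_k,v_k\rangle>0$ for all $k$. *)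

theory Defs
  imports "HOL-Analysis.Analysis"
begin

section \<open>Complex Hilbert spaces\<close>

text \<open>The inner product is antilinear in the first argument. Positive definiteness is
  contained in the norm axiom: a norm vanishes only at \<open>0\<close>, and \<open>sqrt\<close> is negative on
  negative reals.\<close>

class complex_inner = real_normed_vector +
  fixes scaleC :: "complex \<Rightarrow> 'a \<Rightarrow> 'a" (infixr "*\<^sub>C" 75)
    and cinner :: "'a \<Rightarrow> 'a \<Rightarrow> complex"
  assumes scaleC_add_right: "c *\<^sub>C (x + y) = c *\<^sub>C x + c *\<^sub>C y"
    and scaleC_add_left: "(b + c) *\<^sub>C x = b *\<^sub>C x + c *\<^sub>C x"
    and scaleC_scaleC: "b *\<^sub>C c *\<^sub>C x = (b * c) *\<^sub>C x"
    and scaleR_scaleC: "r *\<^sub>R x = complex_of_real r *\<^sub>C x"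
    and cinner_commute: "cinner x y = cnj (cinner y x)"
    and cinner_add_right: "cinner x (y + z) = cinner x y + cinner x z"
    and cinner_scaleC_right: "cinner x (c *\<^sub>C y) = c * cinner x y"
    and norm_eq_sqrt_cinner: "norm x = sqrt (Re (cinner x x))"

class complex_hilbert = complex_inner + complete_space

instantiation complex :: complex_hilbert
begin
definition scaleC_complex :: "complex \<Rightarrow> complex \<Rightarrow> complex" where
  "scaleC_complex c z = c * z"
definition cinner_complex :: "complex \<Rightarrow> complex \<Rightarrow> complex" where
  "cinner_complex w z = cnj w * z"
instance
  by standard (auto simp: scaleC_complex_def cinner_complex_def algebra_simps scaleR_conv_of_real
      cmod_def power2_eq_square)
end

interpretation complex_vector: vector_space "scaleC :: complex \<Rightarrow> 'a \<Rightarrow> 'a::complex_inner"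
  by unfold_locales
    (simp_all add: scaleC_add_right scaleC_add_left scaleC_scaleC scaleR_scaleC[of 1, simplified, symmetric])

abbreviation cspan :: "'a::complex_inner set \<Rightarrow> 'a set" where
  "cspan \<equiv> complex_vector.span"

definition infinite_dimensional :: "'a::complex_inner itself \<Rightarrow> bool" where
  "infinite_dimensional _ \<longleftrightarrow> \<not> (\<exists>S::'a set. finite S \<and> cspan S = UNIV)"

definition orthonormal :: "(nat \<Rightarrow> 'a::complex_inner) \<Rightarrow> bool" where
  "orthonormal u \<longleftrightarrow> (\<forall>j k. cinner (u j) (u k) = (if j = k then 1 else 0))"

definition orthonormal_basis :: "(nat \<Rightarrow> 'a::complex_inner) \<Rightarrow> bool" where
  "orthonormal_basis u \<longleftrightarrow> orthonormal u \<and> closure (cspan (range u)) = UNIV"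


section \<open>Unbounded operators\<close>

text \<open>An operator is identified with its graph, a subset of \<open>'a \<times> 'a\<close>. Hence its domain is
  \<^const>\<open>Domain\<close>, the relation \<open>B \<supset> A\<close> between operators is \<open>A \<subseteq> B\<close>, the \<open>k\<close>-th power (with its
  natural domain) is the relational power \<open>A ^^ k\<close>, and an operator is closed iff its graph is
  closed in the product topology.\<close>

definition linear_operator :: "('a::complex_inner \<times> 'a) set \<Rightarrow> bool" where
  "linear_operator A \<longleftrightarrow>
     single_valued A \<and> (0, 0) \<in> A \<and>
     (\<forall>x y x' y'. (x, y) \<in> A \<longrightarrow> (x', y') \<in> A \<longrightarrow> (x + x', y + y') \<in> A) \<and>
     (\<forall>c x y. (x, y) \<in> A \<longrightarrow> (c *\<^sub>C x, c *\<^sub>C y) \<in> A)"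

text \<open>Unspecified unless \<open>x \<in> Domain A\<close>.\<close>

definition op_apply :: "('a \<times> 'a) set \<Rightarrow> 'a \<Rightarrow> 'a" where
  "op_apply A x = (THE y. (x, y) \<in> A)"

definition op_minus_scalar :: "('a::complex_inner \<times> 'a) set \<Rightarrow> complex \<Rightarrow> ('a \<times> 'a) set" where
  "op_minus_scalar A z = {(x, y - z *\<^sub>C x) | x y. (x, y) \<in> A}"

definition closed_operator :: "('a::complex_inner \<times> 'a) set \<Rightarrow> bool" where
  "closed_operator A \<longleftrightarrow> linear_operator A \<and> closed A"

definition adjoint_op :: "('a::complex_inner \<times> 'a) set \<Rightarrow> ('a \<times> 'a) set" where
  "adjoint_op A = {(x, y). \<forall>(u, v) \<in> A. cinner x v = cinner y u}"

definition selfadjoint :: "('a::complex_inner \<times> 'a) set \<Rightarrow> bool" where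
  "selfadjoint A \<longleftrightarrow> linear_operator A \<and> closure (Domain A) = UNIV \<and> adjoint_op A = A"


section \<open>Spectral measure and simple operators\<close>

definition orthogonal_projection :: "('a::complex_inner \<Rightarrow> 'a) \<Rightarrow> bool" where
  "orthogonal_projection P \<longleftrightarrow>
     (\<forall>x y. P (x + y) = P x + P y) \<and> (\<forall>c x. P (c *\<^sub>C x) = c *\<^sub>C P x) \<and>
     (\<forall>x. P (P x) = P x) \<and> (\<forall>x y. cinner (P x) y = cinner x (P y))"

definition projection_valued_measure :: "(real set \<Rightarrow> 'a::complex_inner \<Rightarrow> 'a) \<Rightarrow> bool" where
  "projection_valued_measure E \<longleftrightarrow>
     (\<forall>S \<in> sets borel. orthogonal_projection (E S)) \<and>
     (\<forall>x. E UNIV x = x) \<and>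
     (\<forall>S :: nat \<Rightarrow> real set. range S \<subseteq> sets borel \<longrightarrow> disjoint_family S \<longrightarrow>
        (\<forall>x. (\<lambda>n. E (S n) x) sums E (\<Union>n. S n) x))"

text \<open>The Borel measure \<open>S \<mapsto> \<langle>x, E(S) x\<rangle>\<close>; the values are nonnegative reals when \<open>E\<close> is a
  projection-valued measure.\<close>

definition diag_measure :: "(real set \<Rightarrow> 'a::complex_inner \<Rightarrow> 'a) \<Rightarrow> 'a \<Rightarrow> real measure" where
  "diag_measure E x = measure_of UNIV (sets borel) (\<lambda>S. ennreal (Re (cinner x (E S x))))"

text \<open>\<open>A = \<integral> \<lambda> dE(\<lambda>)\<close>: the domain consists of the \<open>x\<close> with
  \<open>\<integral> \<lambda>\<^sup>2 d\<langle>x, E(\<lambda>) x\<rangle> < \<infinity>\<close>, and for these \<open>\<langle>x, A x\<rangle> = \<integral> \<lambda> d\<langle>x, E(\<lambda>) x\<rangle>\<close>. The quadratic form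
  on the dense domain determines \<open>A\<close> by polarization. By the spectral theorem every selfadjoint
  \<open>A\<close> has exactly one such \<open>E\<close> (up to its values outside the Borel sets).\<close>

definition spectral_measure_of ::
    "(real set \<Rightarrow> 'a::complex_inner \<Rightarrow> 'a) \<Rightarrow> ('a \<times> 'a) set \<Rightarrow> bool" where
  "spectral_measure_of E A \<longleftrightarrow>
     projection_valued_measure E \<and>
     Domain A = {x. integrable (diag_measure E x) (\<lambda>t. t\<^sup>2)} \<and>
     (\<forall>x \<in> Domain A.
        cinner x (op_apply A x) = complex_of_real (\<integral>t. t \<partial>diag_measure E x))"

definition generating_element :: "(real set \<Rightarrow> 'a::complex_inner \<Rightarrow> 'a) \<Rightarrow> 'a \<Rightarrow> bool" where
  "generating_element E g \<longleftrightarrow> closure (cspan {E S g | S. S \<in> sets borel}) = UNIV"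

definition simple_operator :: "('a::complex_inner \<times> 'a) set \<Rightarrow> bool" where
  "simple_operator A \<longleftrightarrow> (\<exists>E g. spectral_measure_of E A \<and> generating_element E g)"

definition cyclic_vector :: "('a::complex_inner \<times> 'a) set \<Rightarrow> 'a \<Rightarrow> bool" where
  "cyclic_vector A f \<longleftrightarrow>
     (\<forall>k. f \<in> Domain (A ^^ k)) \<and>
     closure (cspan (range (\<lambda>k. op_apply (A ^^ k) f))) = UNIV"


section \<open>Bases of representation and the Gram--Schmidt procedure\<close>

text \<open>All sequences are indexed from \<open>0\<close>.\<close>

definition basis_of_representation ::
    "(nat \<Rightarrow> 'a::complex_inner) \<Rightarrow> ('a \<times> 'a) set \<Rightarrow> bool" where
  "basis_of_representation u A \<longleftrightarrow>
     orthonormal_basis u \<and>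
     (\<forall>k. u k \<in> Domain A) \<and>
     (\<forall>B. closed_operator B \<longrightarrow>
        (\<forall>k. u k \<in> Domain B \<and> op_apply B (u k) = op_apply A (u k)) \<longrightarrow> A \<subseteq> B)"

definition is_gram_schmidt :: "(nat \<Rightarrow> 'a::complex_inner) \<Rightarrow> (nat \<Rightarrow> 'a) \<Rightarrow> bool" where
  "is_gram_schmidt v d \<longleftrightarrow>
     orthonormal d \<and>
     (\<forall>k. cspan (d ` {..k}) = cspan (v ` {..k})) \<and>
     (\<forall>k. \<exists>r>0. cinner (d k) (v k) = complex_of_real r)"

text \<open>Well defined for linearly independent \<open>v\<close>; see \<open>gram_schmidt_ex1\<close> below.\<close>

definition gram_schmidt :: "(nat \<Rightarrow> 'a::complex_inner) \<Rightarrow> nat \<Rightarrow> 'a" where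
  "gram_schmidt v = (THE d. is_gram_schmidt v d)"

lemma cinner_add_left: "cinner (x + y) z = cinner x z + cinner (y::'a::complex_inner) z"
  by (metis cinner_commute cinner_add_right complex_cnj_add)

lemma cinner_scaleC_left: "cinner (c *\<^sub>C x) y = cnj c * cinner (x::'a::complex_inner) y"
  by (metis cinner_commute cinner_scaleC_right complex_cnj_mult)

lemma cinner_zero_right [simp]: "cinner (x::'a::complex_inner) 0 = 0"
  using cinner_add_right[of x 0 0] by simp

lemma cinner_diff_right: "cinner x (y - z) = cinner x y - cinner (x::'a::complex_inner) z"
  using cinner_add_right[of x "y - z" z] by (simp add: algebra_simps)

lemma cinner_sum_right:
  "cinner (x::'a::complex_inner) (\<Sum>i\<in>I. f i) = (\<Sum>i\<in>I. cinner x (f i))"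
  by (induction I rule: infinite_finite_induct) (auto simp: cinner_add_right)

lemma cinner_self: "cinner x x = complex_of_real ((norm (x::'a::complex_inner))\<^sup>2)"
proof (rule complex_eqI)
  show "Im (cinner x x) = Im (complex_of_real ((norm x)\<^sup>2))"
    using arg_cong[OF cinner_commute[of x x], of Im] by simp
  have "Re (cinner x x) \<ge> 0"
    by (metis norm_eq_sqrt_cinner norm_ge_zero real_sqrt_ge_0_iff)
  then show "Re (cinner x x) = Re (complex_of_real ((norm x)\<^sup>2))"
    by (simp add: norm_eq_sqrt_cinner)
qed

lemma cinner_self_eq_0: "cinner x x = 0 \<longleftrightarrow> (x::'a::complex_inner) = 0"
  by (simp add: cinner_self)

lemma orthogonal_cspan:
  assumes "\<And>y. y \<in> S \<Longrightarrow> cinner x y = 0" "z \<in> cspan S"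
  shows "cinner x (z::'a::complex_inner) = 0"
  using assms(2)
  by (induction rule: complex_vector.span_induct_alt)
    (auto simp: cinner_add_right cinner_scaleC_right assms(1))

context
  fixes v :: "nat \<Rightarrow> 'a::complex_inner"
  assumes v: "inj v" "complex_vector.independent (range v)"
begin

lemma notin_cspan_previous: "v k \<notin> cspan (v ` {..<k})"
proof
  assume "v k \<in> cspan (v ` {..<k})"
  moreover have "v ` {..<k} \<subseteq> range v - {v k}"
    using v(1) by (auto simp: inj_def)
  ultimately have "v k \<in> cspan (range v - {v k})"
    using complex_vector.span_mono by blast
  then show False
    using v(2) complex_vector.dependent_def by blast
qed

lemma gram_schmidt_exists: "\<exists>d. is_gram_schmidt v d"
proof -
  define step where "step d n = (let w = v n - (\<Sum>j<n. cinner (d j) (v n) *\<^sub>C d j)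
    in complex_of_real (1 / norm w) *\<^sub>C w)" for d n
  define d where "d = wfrec less_than step"
  have d_rec: "d n = step d n" for n
  proof -
    have "adm_wf less_than step"
      unfolding adm_wf_def
    proof (intro allI impI)
      fix f g :: "nat \<Rightarrow> 'a" and n assume "\<forall>z. (z, n) \<in> less_than \<longrightarrow> f z = g z"
      then have "(\<Sum>j<n. cinner (f j) (v n) *\<^sub>C f j) = (\<Sum>j<n. cinner (g j) (v n) *\<^sub>C g j)"
        by (intro sum.cong) auto
      then show "step f n = step g n"
        by (simp only: step_def)
    qed
    then show ?thesis
      unfolding d_def by (rule wfrec_fixpoint[OF wf_less_than, THEN fun_cong])
  qed
  define w where "w n = v n - (\<Sum>j<n. cinner (d j) (v n) *\<^sub>C d j)" for n
  have d: "d n = complex_of_real (1 / norm (w n)) *\<^sub>C w n" for n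
    by (subst d_rec) (simp add: step_def w_def Let_def)
  have key: "cspan (d ` {..<n}) = cspan (v ` {..<n}) \<and>
      (\<forall>j<n. \<forall>k<n. cinner (d j) (d k) = (if j = k then 1 else 0)) \<and>
      (\<forall>k<n. \<exists>r>0. cinner (d k) (v k) = complex_of_real r)" for n
  proof (induction n)
    case 0
    show ?case by simp
  next
    case (Suc n)
    have sp: "cspan (d ` {..<n}) = cspan (v ` {..<n})"
      and on: "\<And>j k. j < n \<Longrightarrow> k < n \<Longrightarrow> cinner (d j) (d k) = (if j = k then 1 else 0)"
      and pos: "\<And>k. k < n \<Longrightarrow> \<exists>r>0. cinner (d k) (v k) = complex_of_real r"
      using Suc.IH by blast+
    define s where "s = (\<Sum>j<n. cinner (d j) (v n) *\<^sub>C d j)"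
    have s: "s \<in> cspan (d ` {..<n})"
      unfolding s_def
      by (intro complex_vector.span_sum complex_vector.span_scale complex_vector.span_base) auto
    have vn: "v n = w n + s"
      by (simp add: w_def s_def)
    have w0: "w n \<noteq> 0"
      using notin_cspan_previous[of n] s sp vn by auto
    have orth: "cinner (d j) (w n) = 0" if "j < n" for j
    proof -
      have "cinner (d j) s = (\<Sum>i<n. if i = j then cinner (d i) (v n) else 0)"
        unfolding s_def cinner_sum_right cinner_scaleC_right
        by (rule sum.cong) (use that on in auto)
      also have "\<dots> = cinner (d j) (v n)"
        using that by simp
      finally show ?thesis
        by (simp add: vn cinner_add_right)
    qed
    have orth_dn: "cinner (d j) (d n) = 0" "cinner (d n) (d j) = 0" if "j < n" for j
      using orth[OF that] cinner_commute[of "d n" "d j"]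
      by (simp_all add: d[of n] cinner_scaleC_right)
    have dn_wn: "cinner (d n) (w n) = complex_of_real (norm (w n))"
      using w0 by (simp add: d[of n] cinner_scaleC_left cinner_self power2_eq_square)
    have dn_dn: "cinner (d n) (d n) = 1"
    proof -
      have "cinner (d n) (d n) = complex_of_real (1 / norm (w n)) * cinner (d n) (w n)"
        by (subst (2) d) (simp add: cinner_scaleC_right)
      with dn_wn w0 show ?thesis by simp
    qed
    have dn_s: "cinner (d n) s = 0"
      by (rule orthogonal_cspan[OF _ s]) (auto simp: orth_dn)
    have pos_n: "\<exists>r>0. cinner (d n) (v n) = complex_of_real r"
      using w0 by (intro exI[of _ "norm (w n)"]) (simp add: vn cinner_add_right dn_wn dn_s)
    have wn: "w n = complex_of_real (norm (w n)) *\<^sub>C d n"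
      using w0 by (simp add: d[of n] scaleC_scaleC)
    have "cspan (d ` {..<Suc n}) = cspan (v ` {..<Suc n})"
      unfolding complex_vector.span_eq
    proof (intro conjI)
      have s_d: "s \<in> cspan (d ` {..<Suc n})"
        using s complex_vector.span_mono[of "d ` {..<n}" "d ` {..<Suc n}"]
        by (auto simp: lessThan_Suc)
      have s_v: "s \<in> cspan (v ` {..<Suc n})"
        using s sp complex_vector.span_mono[of "v ` {..<n}" "v ` {..<Suc n}"]
        by (auto simp: lessThan_Suc)
      have "v n \<in> cspan (v ` {..<Suc n})"
        by (intro complex_vector.span_base) auto
      then have "w n \<in> cspan (v ` {..<Suc n})"
        using complex_vector.span_diff[OF _ s_v, of "v n"] by (simp add: vn)
      then have "d n \<in> cspan (v ` {..<Suc n})"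
        by (subst d) (rule complex_vector.span_scale)
      moreover have "d ` {..<n} \<subseteq> cspan (v ` {..<Suc n})"
        using sp complex_vector.span_mono[of "v ` {..<n}" "v ` {..<Suc n}"]
          complex_vector.span_superset[of "d ` {..<n}"]
        by (auto simp: lessThan_Suc)
      ultimately show "d ` {..<Suc n} \<subseteq> cspan (v ` {..<Suc n})"
        by (auto simp: lessThan_Suc)
      have "d n \<in> cspan (d ` {..<Suc n})"
        by (intro complex_vector.span_base) auto
      then have "v n \<in> cspan (d ` {..<Suc n})"
        unfolding vn by (subst wn) (intro complex_vector.span_add complex_vector.span_scale s_d)
      moreover have "v ` {..<n} \<subseteq> cspan (d ` {..<Suc n})"
        using sp complex_vector.span_mono[of "d ` {..<n}" "d ` {..<Suc n}"]
          complex_vector.span_superset[of "v ` {..<n}"]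
        by (auto simp: lessThan_Suc)
      ultimately show "v ` {..<Suc n} \<subseteq> cspan (d ` {..<Suc n})"
        by (auto simp: lessThan_Suc)
    qed
    then show ?case
      using on pos pos_n orth_dn dn_dn by (auto simp: less_Suc_eq)
  qed
  have "orthonormal d"
    unfolding orthonormal_def
  proof (intro allI)
    fix j k show "cinner (d j) (d k) = (if j = k then 1 else 0)"
      using key[of "Suc (max j k)"] by (simp add: less_Suc_eq_le)
  qed
  moreover have "cspan (d ` {..k}) = cspan (v ` {..k})" for k
    using key[of "Suc k"] by (simp only: lessThan_Suc_atMost)
  moreover have "\<exists>r>0. cinner (d k) (v k) = complex_of_real r" for k
    using key[of "Suc k"] by blast
  ultimately show ?thesis
    unfolding is_gram_schmidt_def by blast
qed

lemma gram_schmidt_unique: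
  assumes d: "is_gram_schmidt v d" and e: "is_gram_schmidt v e"
  shows "d = e"
proof
  fix n show "d n = e n"
  proof (induction n rule: less_induct)
    case (less n)
    let ?S = "d ` {..<n}"
    have on: "cinner (d j) (d k) = (if j = k then 1 else 0)"
      "cinner (e j) (e k) = (if j = k then 1 else 0)" for j k
      using d e by (auto simp: is_gram_schmidt_def orthonormal_def)
    have img: "e ` {..<n} = ?S"
      using less.IH by force
    have "d n \<in> cspan (d ` {..n})"
      by (intro complex_vector.span_base) auto
    also have "cspan (d ` {..n}) = cspan (e ` {..n})"
      using d e by (simp add: is_gram_schmidt_def)
    also have "e ` {..n} = insert (e n) ?S"
      by (simp add: lessThan_Suc_atMost[symmetric] lessThan_Suc img)
    finally obtain c where c: "d n - c *\<^sub>C e n \<in> cspan ?S"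
      unfolding complex_vector.span_breakdown_eq by blast
    have "cinner (d n) (d n - c *\<^sub>C e n) = 0"
      by (rule orthogonal_cspan[OF _ c]) (auto simp: on)
    moreover have "cinner (e n) (d n - c *\<^sub>C e n) = 0"
      by (rule orthogonal_cspan[OF _ c]) (auto simp: on less.IH)
    ultimately have "cinner (d n - c *\<^sub>C e n) (d n - c *\<^sub>C e n) = 0"
      using cinner_add_left[of "d n - c *\<^sub>C e n" "c *\<^sub>C e n" "d n - c *\<^sub>C e n"]
      by (simp add: cinner_scaleC_left)
    then have dc: "d n = c *\<^sub>C e n"
      by (simp add: cinner_self_eq_0)
    have "cnj c * c = 1"
      using on(1)[of n n] on(2)[of n n]
      by (simp add: dc cinner_scaleC_left cinner_scaleC_right mult.commute)
    obtain r r' where r: "r > 0" "cinner (d n) (v n) = complex_of_real r"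
      and r': "r' > 0" "cinner (e n) (v n) = complex_of_real r'"
      using d e unfolding is_gram_schmidt_def by blast
    have "cnj c * complex_of_real r' = complex_of_real r"
      using r(2) r'(2) by (simp add: dc cinner_scaleC_left)
    then have "cnj c = complex_of_real (r / r')"
      using r'(1) by (simp add: field_simps)
    then have c_real: "c = complex_of_real (r / r')"
      by (metis complex_cnj_cnj complex_cnj_complex_of_real)
    with \<open>cnj c * c = 1\<close> have "complex_of_real (r / r' * (r / r')) = complex_of_real 1"
      by simp
    then have "(r / r')\<^sup>2 = 1"
      unfolding of_real_eq_iff power2_eq_square .
    then have "r / r' = 1"
      using r(1) r'(1) by (simp add: power2_eq_1_iff field_simps)
    then show ?case
      using dc c_real by simp
  qed
qed

lemma gram_schmidt_ex1: "\<exists>!d. is_gram_schmidt v d"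
  using gram_schmidt_exists gram_schmidt_unique by blast

lemma is_gram_schmidt_gram_schmidt: "is_gram_schmidt v (gram_schmidt v)"
  unfolding gram_schmidt_def by (rule theI'[OF gram_schmidt_ex1])

end

end

theory Submission
  imports Defs
begin

text \<open>Let \<open>v k = A\<^sup>k \<delta>\<close> and \<open>D = span {v k}\<close>. Since \<open>D\<close> is dense and \<open>\<H>\<close> is infinite-dimensional,
  \<open>v\<close> is linearly independent: otherwise \<open>D\<close> would be finite-dimensional, hence closed. The
  Gram--Schmidt vectors also span \<open>D\<close>, so they form a basis of representation iff \<open>A\<close> is the
  closure of its restriction to \<open>D\<close>. Because \<open>\<parallel>(A - \<i>) x\<parallel>\<^sup>2 = \<parallel>A x\<parallel>\<^sup>2 + \<parallel>x\<parallel>\<^sup>2\<close>, convergence of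
  \<open>(A - \<i>) x\<^sub>n\<close> is convergence in the graph norm, and \<open>A - \<i>\<close> has dense range as \<open>A\<close> is selfadjoint;
  so this happens iff \<open>(A - \<i>) D\<close> is dense.\<close>

section \<open>Geometry of complex Hilbert spaces\<close>

lemma cinner_diff_left: "cinner (x - y) z = cinner x z - cinner (y::'a::complex_inner) z"
  using cinner_add_left[of "x - y" y z] by simp

text \<open>The class axioms give homogeneity of the norm for real scalars only; the complex case is
  read off from the inner product.\<close>

lemma norm_scaleC: "norm (c *\<^sub>C x) = cmod c * norm (x::'a::complex_inner)"
proof -
  have "complex_of_real ((norm (c *\<^sub>C x))\<^sup>2) = complex_of_real ((cmod c * norm x)\<^sup>2)"
    by (simp add: cinner_self[symmetric] cinner_scaleC_left cinner_scaleC_right power_mult_distrib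
        complex_norm_square mult_ac del: of_real_power)
      (simp add: complex_norm_square[symmetric] cinner_self)
  then have "(norm (c *\<^sub>C x))\<^sup>2 = (cmod c * norm x)\<^sup>2"
    by (simp only: of_real_eq_iff)
  then show ?thesis
    by simp
qed

lemma norm_diff_square:
  "(norm (x - y))\<^sup>2 = (norm x)\<^sup>2 - 2 * Re (cinner y x) + (norm (y::'a::complex_inner))\<^sup>2"
proof -
  have "cinner x y = cnj (cinner y x)"
    by (rule cinner_commute)
  then have "cinner (x - y) (x - y) = cinner x x - (cinner y x + cnj (cinner y x)) + cinner y y"
    by (simp add: cinner_diff_left cinner_diff_right)
  then have "Re (cinner (x - y) (x - y)) = Re (cinner x x) - 2 * Re (cinner y x) + Re (cinner y y)"
    by simp
  then show ?thesis
    by (simp add: cinner_self)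
qed

lemma norm_add_square:
  "(norm (x + y))\<^sup>2 = (norm x)\<^sup>2 + 2 * Re (cinner y x) + (norm (y::'a::complex_inner))\<^sup>2"
proof -
  have "cinner x y = cnj (cinner y x)"
    by (rule cinner_commute)
  then have "cinner (x + y) (x + y) = cinner x x + (cinner y x + cnj (cinner y x)) + cinner y y"
    by (simp add: cinner_add_left cinner_add_right)
  then have "Re (cinner (x + y) (x + y)) = Re (cinner x x) + 2 * Re (cinner y x) + Re (cinner y y)"
    by simp
  then show ?thesis
    by (simp add: cinner_self)
qed

lemma parallelogram_law:
  "(norm (x + y))\<^sup>2 + (norm (x - y))\<^sup>2 = 2 * (norm x)\<^sup>2 + 2 * (norm (y::'a::complex_inner))\<^sup>2"
  by (simp add: norm_add_square norm_diff_square)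

text \<open>The multiple of \<open>y\<close> subtracted here is the best approximation of \<open>x\<close> on the line through \<open>y\<close>.\<close>

lemma norm_diff_projection:
  fixes x y :: "'a::complex_inner"
  assumes "y \<noteq> 0"
  shows "(norm (x - (cinner y x / (norm y)\<^sup>2) *\<^sub>C y))\<^sup>2 = (norm x)\<^sup>2 - (cmod (cinner y x))\<^sup>2 / (norm y)\<^sup>2"
proof -
  let ?c = "cinner y x" and ?n = "(norm y)\<^sup>2"
  have n: "?n > 0"
    using assms by simp
  have "Re (cinner ((?c / ?n) *\<^sub>C y) x) = Re (cnj ?c * ?c / ?n)"
    by (simp add: cinner_scaleC_left)
  also have "cnj ?c * ?c / ?n = complex_of_real ((cmod ?c)\<^sup>2 / ?n)"
    by (simp add: complex_norm_square mult.commute del: of_real_power)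
  finally have *: "Re (cinner ((?c / ?n) *\<^sub>C y) x) = (cmod ?c)\<^sup>2 / ?n"
    by simp
  have "(norm ((?c / ?n) *\<^sub>C y))\<^sup>2 = (cmod ?c / ?n * norm y)\<^sup>2"
    by (simp add: norm_scaleC norm_divide norm_power)
  also have "\<dots> = (cmod ?c)\<^sup>2 / ?n"
    using n by (simp add: power_mult_distrib power_divide power2_eq_square)
  finally have **: "(norm ((?c / ?n) *\<^sub>C y))\<^sup>2 = (cmod ?c)\<^sup>2 / ?n" .
  show ?thesis
    unfolding norm_diff_square * ** by simp
qed

text \<open>Subtracting from \<open>y\<close> its component along \<open>x\<close> leaves a vector
  whose squared norm, computed in \<open>norm_diff_projection\<close>, is nonnegative.\<close>

lemma Cauchy_Schwarz_cinner: "cmod (cinner x y) \<le> norm x * norm (y::'a::complex_inner)"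
proof (cases "x = 0")
  case True
  then have "cinner x y = 0"
    using cinner_commute[of x y] by simp
  then show ?thesis
    by simp
next
  case False
  then have "(cmod (cinner x y))\<^sup>2 / (norm x)\<^sup>2 \<le> (norm y)\<^sup>2"
    using norm_diff_projection[OF False, of y] by (metis diff_ge_0_iff_ge zero_le_power2)
  then have "(cmod (cinner x y))\<^sup>2 \<le> (norm x * norm y)\<^sup>2"
    using False by (simp add: divide_le_eq power_mult_distrib mult.commute)
  then show ?thesis
    by (rule power2_le_imp_le) simp
qed

lemma bounded_linear_cinner_right: "bounded_linear (cinner (x::'a::complex_inner))"
  using Cauchy_Schwarz_cinner[of x]
  by (intro bounded_linear_intro[of _ "norm x"])
    (auto simp: cinner_add_right scaleR_scaleC cinner_scaleC_right scaleC_complex_def mult.commute)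

text \<open>Antilinearity over the complex numbers is still real linearity, which is all that
  \<open>bounded_linear\<close> asks for.\<close>

lemma bounded_linear_cinner_left: "bounded_linear (\<lambda>x. cinner x (y::'a::complex_inner))"
  using Cauchy_Schwarz_cinner[of _ y]
  by (intro bounded_linear_intro[of _ "norm y"])
    (auto simp: cinner_add_left scaleR_scaleC cinner_scaleC_left scaleC_complex_def)

lemma bounded_linear_scaleC_right: "bounded_linear (\<lambda>x::'a::complex_inner. c *\<^sub>C x)"
  by (intro bounded_linear_intro[of _ "cmod c"])
    (auto simp: scaleC_add_right scaleR_scaleC scaleC_scaleC norm_scaleC mult.commute)

lemma bounded_linear_scaleC_left: "bounded_linear (\<lambda>c. c *\<^sub>C (x::'a::complex_inner))"
  by (intro bounded_linear_intro[of _ "norm x"])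
    (auto simp: scaleC_add_left scaleR_scaleC scaleC_scaleC norm_scaleC scaleC_complex_def)

lemmas tendsto_scaleC_right = bounded_linear.tendsto[OF bounded_linear_scaleC_right]
lemmas tendsto_scaleC_left = bounded_linear.tendsto[OF bounded_linear_scaleC_left]
lemmas continuous_on_cinner_right = bounded_linear.continuous_on[OF bounded_linear_cinner_right]
lemmas continuous_on_scaleC_right = bounded_linear.continuous_on[OF bounded_linear_scaleC_right]

section \<open>Closed subspaces and orthogonal vectors\<close>

lemma subspace_closure:
  fixes S :: "'a::complex_inner set"
  assumes "complex_vector.subspace S"
  shows "complex_vector.subspace (closure S)"
proof (rule complex_vector.subspaceI)
  show "0 \<in> closure S"
    using assms closure_subset complex_vector.subspace_0 by blast
next
  fix x y assume "x \<in> closure S" "y \<in> closure S"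
  then obtain a b where "\<And>n. a n \<in> S" "a \<longlonglongrightarrow> x" "\<And>n. b n \<in> S" "b \<longlonglongrightarrow> y"
    unfolding closure_sequential by blast
  then show "x + y \<in> closure S"
    unfolding closure_sequential
    by (intro exI[of _ "\<lambda>n. a n + b n"])
      (auto intro: tendsto_add complex_vector.subspace_add[OF assms])
next
  fix c x assume "x \<in> closure S"
  then obtain a where "\<And>n. a n \<in> S" "a \<longlonglongrightarrow> x"
    unfolding closure_sequential by blast
  then show "c *\<^sub>C x \<in> closure S"
    unfolding closure_sequential
    by (intro exI[of _ "\<lambda>n. c *\<^sub>C a n"])
      (auto intro: tendsto_scaleC_right complex_vector.subspace_scale[OF assms])
qed

text \<open>A minimizing sequence is Cauchy by the parallelogram law: the midpoint of two of its
  members stays in \<open>S\<close>, so its distance from \<open>x\<close> is at least the infimum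
  \<open>d\<close>. Completeness gives a limit and closedness keeps it in \<open>S\<close>.\<close>

lemma nearest_point_exists:
  fixes S :: "'a::complex_hilbert set"
  assumes sub: "complex_vector.subspace S" and cl: "closed S"
  shows "\<exists>s\<in>S. \<forall>t\<in>S. norm (x - s) \<le> norm (x - t)"
proof -
  have ne: "S \<noteq> {}"
    using complex_vector.subspace_0[OF sub] by blast
  define d where "d = infdist x S"
  have d: "d \<le> norm (x - t)" if "t \<in> S" for t
    using infdist_le[OF that, of x] by (simp add: d_def dist_norm)
  have d0: "d \<ge> 0"
    by (simp add: d_def infdist_nonneg)
  have "\<exists>s\<in>S. norm (x - s) < d + e" if "e > 0" for e
  proof (rule ccontr)
    assume "\<not> ?thesis"
    then have "d + e \<le> infdist x S"
      using ne by (auto simp: infdist_def dist_norm not_less intro!: cINF_greatest)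
    with that show False
      by (simp add: d_def)
  qed
  then have "\<forall>n. \<exists>s\<in>S. norm (x - s) < d + inverse (real (Suc n))"
    by simp
  then obtain s where s: "\<And>n. s n \<in> S" "\<And>n. norm (x - s n) < d + inverse (real (Suc n))"
    by metis
  have lim: "(\<lambda>n. norm (x - s n)) \<longlonglongrightarrow> d"
  proof (rule tendsto_sandwich[OF _ _ tendsto_const])
    show "(\<lambda>n. d + inverse (real (Suc n))) \<longlonglongrightarrow> d"
      using tendsto_add[OF tendsto_const LIMSEQ_inverse_real_of_nat, of d] by simp
  qed (use s d in \<open>auto intro: always_eventually less_imp_le\<close>)
  have est: "(norm (s m - s n))\<^sup>2 \<le> 2 * (norm (x - s m))\<^sup>2 + 2 * (norm (x - s n))\<^sup>2 - 4 * d\<^sup>2" for m n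
  proof -
    let ?t = "(1/2) *\<^sub>R (s m + s n)"
    have "?t \<in> S"
      unfolding scaleR_scaleC
      by (intro complex_vector.subspace_scale complex_vector.subspace_add sub s)
    then have "d\<^sup>2 \<le> (norm (x - ?t))\<^sup>2"
      using d d0 by (intro power_mono) auto
    moreover have "(x - s m) + (x - s n) = 2 *\<^sub>R (x - ?t)"
      by (simp add: algebra_simps scaleR_2)
    then have "(norm ((x - s m) + (x - s n)))\<^sup>2 = 4 * (norm (x - ?t))\<^sup>2"
      by (simp add: power_mult_distrib)
    moreover have "norm ((x - s m) - (x - s n)) = norm (s m - s n)"
      by (simp add: norm_minus_commute)
    ultimately show ?thesis
      using parallelogram_law[of "x - s m" "x - s n"] by simp
  qed
  have "Cauchy s"
  proof (rule CauchyI)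
    fix e :: real assume e: "e > 0"
    \<comment> \<open>Two squared distances exceeding \<open>d\<^sup>2\<close> by less than a
      quarter of \<open>e\<^sup>2\<close> make the bound in \<open>est\<close> less than
      \<open>e\<^sup>2\<close>.\<close>
    have "(\<lambda>n. (norm (x - s n))\<^sup>2) \<longlonglongrightarrow> d\<^sup>2"
      by (intro tendsto_power lim)
    then have "\<forall>\<^sub>F n in sequentially. (norm (x - s n))\<^sup>2 < d\<^sup>2 + e\<^sup>2 / 4"
      by (rule order_tendstoD) (use e in simp)
    then obtain N where N: "\<And>n. n \<ge> N \<Longrightarrow> (norm (x - s n))\<^sup>2 < d\<^sup>2 + e\<^sup>2 / 4"
      by (auto simp: eventually_sequentially)
    show "\<exists>M. \<forall>m\<ge>M. \<forall>n\<ge>M. norm (s m - s n) < e"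
    proof (intro exI allI impI)
      fix m n assume "N \<le> m" "N \<le> n"
      then have "(norm (s m - s n))\<^sup>2 < e\<^sup>2"
        using est[of m n] N[of m] N[of n] by linarith
      then show "norm (s m - s n) < e"
        using e by (simp add: power2_less_imp_less)
    qed
  qed
  then obtain l where l: "s \<longlonglongrightarrow> l"
    using Cauchy_convergent convergent_def by blast
  have "l \<in> S"
    using closed_sequentially[OF cl _ l] s by blast
  moreover have "norm (x - l) = d"
    by (rule LIMSEQ_unique[OF _ lim]) (intro tendsto_intros l)
  ultimately show ?thesis
    using d by auto
qed

text \<open>Take \<open>y = x - s\<close> with \<open>s\<close> nearest to \<open>x\<close> in
  \<open>S\<close>. If \<open>y\<close> had a nonzero component along some \<open>t\<close> in
  \<open>S\<close>, moving \<open>s\<close> by that component would stay in \<open>S\<close> and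
  come strictly closer to \<open>x\<close>.\<close>

lemma nontrivial_orthogonal_vector:
  fixes S :: "'a::complex_hilbert set"
  assumes sub: "complex_vector.subspace S" and cl: "closed S" and "S \<noteq> UNIV"
  obtains y where "y \<noteq> 0" "\<And>t. t \<in> S \<Longrightarrow> cinner y t = 0"
proof -
  obtain x where x: "x \<notin> S"
    using assms(3) by blast
  obtain s where s: "s \<in> S" and near: "\<And>t. t \<in> S \<Longrightarrow> norm (x - s) \<le> norm (x - t)"
    using nearest_point_exists[OF sub cl] by blast
  define y where "y = x - s"
  have "cinner y t = 0" if t: "t \<in> S" for t
  proof (cases "t = 0")
    case False
    let ?p = "(cinner t y / (norm t)\<^sup>2) *\<^sub>C t"
    have "s + ?p \<in> S"
      by (intro complex_vector.subspace_add complex_vector.subspace_scale sub s t)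
    from near[OF this] have "norm y \<le> norm (y - ?p)"
      by (simp add: y_def algebra_simps)
    then have "(norm y)\<^sup>2 \<le> (norm (y - ?p))\<^sup>2"
      by (rule power_mono) simp
    then have "(cmod (cinner t y))\<^sup>2 / (norm t)\<^sup>2 \<le> 0"
      unfolding norm_diff_projection[OF False] by simp
    then have "cinner t y = 0"
      using False by (simp add: divide_le_0_iff)
    then show ?thesis
      using cinner_commute[of y t] by simp
  qed simp
  moreover have "y \<noteq> 0"
    using x s by (auto simp: y_def)
  ultimately show thesis
    using that by blast
qed

section \<open>Finite spans and linearly independent sequences\<close>

text \<open>Induction on the generators. A new generator \<open>a\<close> outside the closed span of
  the others has positive distance \<open>d\<close> from it, which controls the coefficient of
  \<open>a\<close> by the norm of the whole vector. Hence the coefficients along a convergent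
  sequence converge too.\<close>

lemma closed_cspan_finite:
  fixes S :: "'a::complex_inner set"
  assumes "finite S"
  shows "closed (cspan S)"
  using assms
proof (induction S rule: finite_induct)
  case (insert a S)
  show ?case
  proof (cases "a \<in> cspan S")
    case True
    then show ?thesis
      using insert.IH by (simp add: complex_vector.span_redundant)
  next
    case False
    define d where "d = infdist a (cspan S)"
    have "d > 0"
      unfolding d_def using False insert.IH complex_vector.span_zero[of S]
      by (intro infdist_pos_not_in_closed) auto
    \<comment> \<open>Factoring out \<open>c\<close> leaves the difference of \<open>a\<close> and a
      vector of the old span, so its norm is at least \<open>d\<close>.\<close>
    have coeff_bound: "cmod c * d \<le> norm (c *\<^sub>C a + s)" if s: "s \<in> cspan S" for c s
    proof (cases "c = 0")
      case False
      have "(- inverse c) *\<^sub>C s \<in> cspan S"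
        by (intro complex_vector.span_scale s)
      then have "d \<le> norm (a - (- inverse c) *\<^sub>C s)"
        unfolding d_def dist_norm[symmetric] by (rule infdist_le)
      then have "cmod c * d \<le> norm (c *\<^sub>C (a - (- inverse c) *\<^sub>C s))"
        unfolding norm_scaleC by (rule mult_left_mono) simp
      also have "c *\<^sub>C (a - (- inverse c) *\<^sub>C s) = c *\<^sub>C a + s"
        using False by (simp add: scaleC_add_right scaleC_scaleC)
      finally show ?thesis .
    qed simp
    show ?thesis
      unfolding closed_sequential_limits
    proof (intro allI impI, elim conjE)
      fix z l assume z: "\<forall>n. z n \<in> cspan (insert a S)" and l: "z \<longlonglongrightarrow> l"
      have "\<forall>n. \<exists>k. z n - k *\<^sub>C a \<in> cspan S"
        using z by (simp add: complex_vector.span_breakdown_eq)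
      then obtain c where c: "\<And>n. z n - c n *\<^sub>C a \<in> cspan S"
        by metis
      have bound: "cmod (c m - c n) * d \<le> norm (z m - z n)" for m n
      proof -
        let ?s = "(z m - c m *\<^sub>C a) - (z n - c n *\<^sub>C a)"
        have "cmod (c m - c n) * d \<le> norm ((c m - c n) *\<^sub>C a + ?s)"
          by (intro coeff_bound complex_vector.span_diff c)
        also have "(c m - c n) *\<^sub>C a + ?s = z m - z n"
          by (simp add: complex_vector.scale_left_diff_distrib)
        finally show ?thesis .
      qed
      have "Cauchy c"
      proof (rule CauchyI)
        fix e :: real assume "e > 0"
        then obtain M where M: "\<And>m n. m \<ge> M \<Longrightarrow> n \<ge> M \<Longrightarrow> norm (z m - z n) < e * d"
          using CauchyD[OF LIMSEQ_imp_Cauchy[OF l], of "e * d"] \<open>d > 0\<close> by auto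
        show "\<exists>M. \<forall>m\<ge>M. \<forall>n\<ge>M. norm (c m - c n) < e"
        proof (intro exI allI impI)
          fix m n assume "M \<le> m" "M \<le> n"
          then have "cmod (c m - c n) * d < e * d"
            using bound[of m n] M[of m n] by simp
          then show "cmod (c m - c n) < e"
            using \<open>d > 0\<close> by simp
        qed
      qed
      then obtain k where k: "c \<longlonglongrightarrow> k"
        using Cauchy_convergent convergent_def by blast
      have "(\<lambda>n. z n - c n *\<^sub>C a) \<longlonglongrightarrow> l - k *\<^sub>C a"
        by (intro tendsto_diff l tendsto_scaleC_left k)
      then have "l - k *\<^sub>C a \<in> cspan S"
        by (rule closed_sequentially[OF insert.IH c])
      then show "l \<in> cspan (insert a S)"
        unfolding complex_vector.span_breakdown_eq by blast
    qed
  qed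
qed simp

text \<open>Supplies both hypotheses of \<open>is_gram_schmidt_gram_schmidt\<close> from a stepwise
  criterion. Injectivity is separate because \<open>range v\<close> forgets repetitions;
  independence passes from the initial segments to their increasing union.\<close>

lemma independent_sequence:
  fixes v :: "nat \<Rightarrow> 'a::complex_inner"
  assumes v: "\<And>n. v n \<notin> cspan (v ` {..<n})"
  shows "inj v" and "complex_vector.independent (range v)"
proof -
  have "v j \<noteq> v k" if "j < k" for j k
  proof
    assume "v j = v k"
    then have "v k \<in> v ` {..<k}"
      using that by (metis imageI lessThan_iff)
    then have "v k \<in> cspan (v ` {..<k})"
      by (rule complex_vector.span_base)
    then show False
      using v by simp
  qed
  then show "inj v"
    by (intro linorder_injI) auto
  have "complex_vector.independent (v ` {..<n})" for n
    by (induction n)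
      (simp_all add: lessThan_Suc complex_vector.independent_empty complex_vector.independent_insert v)
  then have "complex_vector.independent (\<Union>(range (\<lambda>n. v ` {..<n})))"
  proof (intro complex_vector.independent_Union_directed)
    fix S T assume "S \<in> range (\<lambda>n. v ` {..<n})" "T \<in> range (\<lambda>n. v ` {..<n})"
    then obtain m n where "S = v ` {..<m}" "T = v ` {..<n}"
      by blast
    then show "S \<subseteq> T \<or> T \<subseteq> S"
      using linear[of m n] image_mono[of "{..<m}" "{..<n}" v] image_mono[of "{..<n}" "{..<m}" v]
      by auto
  qed auto
  moreover have "\<Union>(range (\<lambda>n. v ` {..<n})) = range v"
    by auto
  ultimately show "complex_vector.independent (range v)"
    by simp
qed

section \<open>Closed and selfadjoint operators\<close>

lemma op_apply_eq:
  assumes "single_valued A" "(x, y) \<in> A"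
  shows "op_apply A x = y"
  unfolding op_apply_def using assms by (auto simp: single_valued_def)

lemma op_apply_in:
  assumes "single_valued A" "x \<in> Domain A"
  shows "(x, op_apply A x) \<in> A"
  using assms op_apply_eq by fastforce

lemma single_valued_relpow:
  fixes A :: "('a \<times> 'a) set"
  assumes "single_valued A"
  shows "single_valued (A ^^ k)"
proof (induction k)
  case 0
  show ?case
    by simp
next
  case (Suc k)
  then show ?case
    using assms by (simp add: single_valued_relcomp)
qed

text \<open>In \<open>A ^^ Suc k\<close> the factor \<open>A\<close> acts last, so the intermediate
  point is the value of \<open>A ^^ k\<close> at \<open>f\<close>.\<close>

lemma op_apply_relpow_Suc:
  assumes A: "single_valued A" and dom: "\<And>k. f \<in> Domain (A ^^ k)"
  shows "(op_apply (A ^^ k) f, op_apply (A ^^ Suc k) f) \<in> A"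
proof -
  obtain y where "(f, y) \<in> A ^^ Suc k"
    using dom by blast
  then obtain z where "(f, z) \<in> A ^^ k" "(z, y) \<in> A"
    by auto
  then show ?thesis
    using \<open>(f, y) \<in> A ^^ Suc k\<close> op_apply_eq single_valued_relpow[OF A] by metis
qed

lemma op_apply_op_minus_scalar:
  assumes "single_valued A" "(x, y) \<in> A"
  shows "op_apply (op_minus_scalar A z) x = y - z *\<^sub>C x"
  using assms by (intro op_apply_eq) (auto simp: op_minus_scalar_def single_valued_def)

lemma linear_operatorD:
  assumes "linear_operator A"
  shows "single_valued A" "(0, 0) \<in> A"
    "\<And>x y x' y'. (x, y) \<in> A \<Longrightarrow> (x', y') \<in> A \<Longrightarrow> (x + x', y + y') \<in> A"
    "\<And>c x y. (x, y) \<in> A \<Longrightarrow> (c *\<^sub>C x, c *\<^sub>C y) \<in> A"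
  using assms unfolding linear_operator_def by blast+

lemma linear_operator_diff:
  assumes A: "linear_operator A" and "(x, y) \<in> A" "(x', y') \<in> A"
  shows "(x - x', y - y') \<in> A"
  using linear_operatorD(3)[OF A assms(2) linear_operatorD(4)[OF A assms(3), of "-1"]]
  by simp

text \<open>Each pair in \<open>A\<close> imposes one equation between continuous functions, and the
  adjoint is the intersection of the solution sets.\<close>

lemma closed_adjoint_op: "closed (adjoint_op A)"
proof -
  have "closed {(x, y). cinner x v = cinner y u}" for u v :: 'a
    unfolding split_def
    by (intro closed_Collect_eq bounded_linear.continuous_on[OF bounded_linear_cinner_left]
        continuous_intros)
  moreover have "adjoint_op A = (\<Inter>(u, v)\<in>A. {(x, y). cinner x v = cinner y u})"
    by (auto simp: adjoint_op_def)
  ultimately show ?thesis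
    by auto
qed

lemma selfadjoint_closed: "selfadjoint A \<Longrightarrow> closed_operator A"
  unfolding selfadjoint_def closed_operator_def by (metis closed_adjoint_op)

lemma selfadjoint_symmetric:
  assumes "selfadjoint A" "(x, y) \<in> A" "(u, v) \<in> A"
  shows "cinner x v = cinner y u"
proof -
  have "(x, y) \<in> adjoint_op A"
    using assms by (simp add: selfadjoint_def)
  then show ?thesis
    using assms(3) by (auto simp: adjoint_op_def)
qed

text \<open>The closure of a linear graph can fail to be single-valued; here it lies inside the
  closed operator \<open>A\<close> and inherits single-valuedness from it.\<close>

lemma closed_operator_closure:
  assumes B: "linear_operator B" and "B \<subseteq> A" and A: "closed_operator A"
  shows "closed_operator (closure B)"
  unfolding closed_operator_def linear_operator_def
proof (intro conjI allI impI)
  have "closure B \<subseteq> A"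
    using assms by (simp add: closure_minimal closed_operator_def)
  then show "single_valued (closure B)"
    using A single_valued_subset unfolding closed_operator_def linear_operator_def by blast
  show "(0, 0) \<in> closure B"
    using linear_operatorD(2)[OF B] closure_subset by blast
next
  fix x y x' y' assume "(x, y) \<in> closure B" "(x', y') \<in> closure B"
  then obtain p q where p: "\<And>n. p n \<in> B" "p \<longlonglongrightarrow> (x, y)" and q: "\<And>n. q n \<in> B" "q \<longlonglongrightarrow> (x', y')"
    unfolding closure_sequential by blast
  have "(\<lambda>n. p n + q n) \<longlonglongrightarrow> (x + x', y + y')"
    using tendsto_add[OF p(2) q(2)] by simp
  moreover have "p n + q n \<in> B" for n
    using linear_operatorD(3)[OF B, of "fst (p n)" "snd (p n)" "fst (q n)" "snd (q n)"] p(1) q(1)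
    by (simp add: plus_prod_def)
  ultimately show "(x + x', y + y') \<in> closure B"
    unfolding closure_sequential by (intro CollectI exI[of _ "\<lambda>n. p n + q n"] conjI allI)
next
  fix c x y assume "(x, y) \<in> closure B"
  then obtain p where p: "\<And>n. p n \<in> B" "p \<longlonglongrightarrow> (x, y)"
    unfolding closure_sequential by blast
  have "(\<lambda>n. (c *\<^sub>C fst (p n), c *\<^sub>C snd (p n))) \<longlonglongrightarrow> (c *\<^sub>C x, c *\<^sub>C y)"
    using tendsto_fst[OF p(2)] tendsto_snd[OF p(2)] by (auto intro!: tendsto_Pair tendsto_scaleC_right)
  moreover have "(c *\<^sub>C fst (p n), c *\<^sub>C snd (p n)) \<in> B" for n
    using linear_operatorD(4)[OF B, of "fst (p n)" "snd (p n)" c] p(1) by simp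
  ultimately show "(c *\<^sub>C x, c *\<^sub>C y) \<in> closure B"
    unfolding closure_sequential
    by (intro CollectI exI[of _ "\<lambda>n. (c *\<^sub>C fst (p n), c *\<^sub>C snd (p n))"]) auto
qed simp

section \<open>Restrictions of operators and their action on spans\<close>

lemma linear_operator_restrict:
  assumes A: "linear_operator A" and "complex_vector.subspace D"
  shows "linear_operator {(x, y) \<in> A. x \<in> D}"
  using A assms(2) unfolding linear_operator_def
  by (auto simp: single_valued_def complex_vector.subspace_0 complex_vector.subspace_add
      complex_vector.subspace_scale)

text \<open>Stated for linear relations so that it also covers the converse of an operator, which
  need not be single-valued; one induction then serves for images and preimages.\<close>

lemma linear_relation_cspan_image:
  fixes R :: "('a::complex_inner \<times> 'a) set"
  assumes zero: "(0, 0) \<in> R"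
    and add: "\<And>x y x' y'. (x, y) \<in> R \<Longrightarrow> (x', y') \<in> R \<Longrightarrow> (x + x', y + y') \<in> R"
    and scale: "\<And>c x y. (x, y) \<in> R \<Longrightarrow> (c *\<^sub>C x, c *\<^sub>C y) \<in> R"
    and v: "\<And>k. (v k, w k) \<in> R" and x: "x \<in> cspan (v ` I)"
  shows "\<exists>y \<in> cspan (w ` I). (x, y) \<in> R"
  using x
proof (induction rule: complex_vector.span_induct_alt)
  case base
  then show ?case
    using zero complex_vector.span_zero by blast
next
  case (step c x z)
  then obtain k y where k: "k \<in> I" "x = v k" and y: "y \<in> cspan (w ` I)" "(z, y) \<in> R"
    by blast
  have "c *\<^sub>C w k + y \<in> cspan (w ` I)"
    using k y by (intro complex_vector.span_add complex_vector.span_scale)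
      (auto intro: complex_vector.span_base)
  moreover have "(c *\<^sub>C x + z, c *\<^sub>C w k + y) \<in> R"
    using add scale v k y by blast
  ultimately show ?case
    by blast
qed

lemma linear_operator_cspan_image:
  assumes A: "linear_operator A" and v: "\<And>k. (v k, w k) \<in> A" and x: "x \<in> cspan (v ` I)"
  shows "\<exists>y \<in> cspan (w ` I). (x, y) \<in> A"
  by (intro linear_relation_cspan_image[OF _ _ _ v x] linear_operatorD[OF A])

lemma linear_operator_cspan_preimage:
  assumes A: "linear_operator A" and v: "\<And>k. (v k, w k) \<in> A" and y: "y \<in> cspan (w ` I)"
  shows "\<exists>x \<in> cspan (v ` I). (x, y) \<in> A"
  using linear_relation_cspan_image[of "A\<inverse>" w v y I] linear_operatorD[OF A] v y by auto

lemma linear_operator_op_minus_scalar: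
  assumes "linear_operator A"
  shows "linear_operator (op_minus_scalar A z)"
  unfolding linear_operator_def
proof (intro conjI allI impI)
  note A = linear_operatorD[OF assms]
  show "single_valued (op_minus_scalar A z)"
    using A(1) by (auto simp: op_minus_scalar_def single_valued_def)
  show "(0, 0) \<in> op_minus_scalar A z"
    using A(2) by (force simp: op_minus_scalar_def)
  fix x y
  assume "(x, y) \<in> op_minus_scalar A z"
  then have xy: "(x, y + z *\<^sub>C x) \<in> A"
    by (auto simp: op_minus_scalar_def)
  show "(c *\<^sub>C x, c *\<^sub>C y) \<in> op_minus_scalar A z" for c
    using A(4)[OF xy, of c]
    by (force simp: op_minus_scalar_def complex_vector.scale_right_distrib mult.commute)
  fix x' y' assume "(x', y') \<in> op_minus_scalar A z"
  then have x'y': "(x', y' + z *\<^sub>C x') \<in> A"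
    by (auto simp: op_minus_scalar_def)
  show "(x + x', y + y') \<in> op_minus_scalar A z"
    using A(3)[OF xy x'y'] by (force simp: op_minus_scalar_def complex_vector.scale_right_distrib)
qed

text \<open>The intersection \<open>A \<inter> B\<close> is again a linear operator. Its domain
  contains every \<open>u k\<close>, hence their span.\<close>

lemma linear_operator_extends_on_cspan:
  assumes A: "linear_operator A" and B: "linear_operator B"
    and u: "\<And>k. (u k, w k) \<in> A" "\<And>k. (u k, w k) \<in> B"
  shows "{(x, y) \<in> A. x \<in> cspan (range u)} \<subseteq> B"
proof clarify
  fix x y assume xy: "(x, y) \<in> A" and x: "x \<in> cspan (range u)"
  have "linear_operator (A \<inter> B)"
    using A B unfolding linear_operator_def by (auto simp: single_valued_def)
  then obtain z where "(x, z) \<in> A \<inter> B"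
    using linear_operator_cspan_image[of "A \<inter> B" u w] u x by blast
  then show "(x, y) \<in> B"
    using linear_operatorD(1)[OF A] xy by (auto simp: single_valued_def)
qed

section \<open>The operator \<open>A - \<i>\<close> for selfadjoint \<open>A\<close>\<close>

text \<open>The cross term is a multiple of the imaginary part of \<open>cinner x y\<close>, which
  is real by symmetry.\<close>

lemma norm_selfadjoint_minus_ii:
  assumes "selfadjoint A" "(x, y) \<in> A"
  shows "(norm (y - \<i> *\<^sub>C x))\<^sup>2 = (norm y)\<^sup>2 + (norm x)\<^sup>2"
proof -
  have "cinner x y = cnj (cinner x y)"
    using selfadjoint_symmetric[OF assms assms(2)] cinner_commute by metis
  then have "Im (cinner x y) = 0"
    by (simp add: complex_eq_iff)
  then show ?thesis
    by (simp add: norm_diff_square cinner_scaleC_left norm_scaleC)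
qed

text \<open>Here \<open>C\<close> plays the role of a core of \<open>A\<close>: a vector orthogonal to its range under \<open>A - \<i>\<close> would
  be an eigenvector of \<open>A\<close> for the eigenvalue \<open>-\<i>\<close>.\<close>

lemma selfadjoint_core_orthogonal:
  assumes A: "selfadjoint A" and C: "A \<subseteq> closure C"
    and y: "\<And>u v. (u, v) \<in> C \<Longrightarrow> cinner y (v - \<i> *\<^sub>C u) = 0"
  shows "y = 0"
proof -
  have "closed {p. cinner y (snd p - \<i> *\<^sub>C fst p) = 0}"
    by (intro closed_Collect_eq continuous_on_cinner_right continuous_on_scaleC_right
        continuous_intros)
  then have "closure C \<subseteq> {p. cinner y (snd p - \<i> *\<^sub>C fst p) = 0}"
    by (rule closure_minimal[rotated]) (use y in auto)
  then have "cinner y (v - \<i> *\<^sub>C u) = 0" if "(u, v) \<in> A" for u v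
    using that C by fastforce
  \<comment> \<open>Orthogonality turns \<open>cinner y v\<close> into
    \<open>\<i> * cinner y u\<close>, and antilinearity moves the factor to the first argument as
    \<open>- \<i>\<close>.\<close>
  then have "(y, (- \<i>) *\<^sub>C y) \<in> adjoint_op A"
    by (auto simp: adjoint_op_def cinner_diff_right cinner_scaleC_right cinner_scaleC_left
        simp del: complex_vector.scale_minus_left)
  then have "(y, (- \<i>) *\<^sub>C y) \<in> A"
    using A by (simp add: selfadjoint_def)
  \<comment> \<open>Symmetry for this pair with itself equates \<open>- \<i> * cinner y y\<close>
    and \<open>\<i> * cinner y y\<close>.\<close>
  from selfadjoint_symmetric[OF A this this] have "cinner y y = 0"
    by (simp add: cinner_scaleC_right cinner_scaleC_left complex_eq_iff
        del: complex_vector.scale_minus_left)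
  then show ?thesis
    by (simp add: cinner_self_eq_0)
qed

section \<open>Powers at a cyclic vector and their Gram-Schmidt vectors\<close>

text \<open>If \<open>v n\<close> lay in the span \<open>W\<close> of its predecessors,
  \<open>A\<close> would map \<open>W\<close> into itself, so every \<open>v k\<close> would lie in
  \<open>W\<close>. Being closed and dense, \<open>W\<close> would be the whole space.\<close>

lemma cyclic_vector_independent:
  fixes A :: "('a::complex_inner \<times> 'a) set"
  assumes inf: "infinite_dimensional TYPE('a)" and A: "linear_operator A" and cyc: "cyclic_vector A f"
  defines "v \<equiv> \<lambda>k. op_apply (A ^^ k) f"
  shows "inj v" and "complex_vector.independent (range v)"
proof -
  have step: "(v k, v (Suc k)) \<in> A" for k
    unfolding v_def
    by (intro op_apply_relpow_Suc linear_operatorD(1)[OF A]) (use cyc in \<open>simp add: cyclic_vector_def\<close>)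
  have "v n \<notin> cspan (v ` {..<n})" for n
  proof
    let ?W = "cspan (v ` {..<n})"
    assume n: "v n \<in> ?W"
    have "v ` {..<Suc n} \<subseteq> ?W"
      using n complex_vector.span_superset[of "v ` {..<n}"] by (simp add: lessThan_Suc)
    then have sub: "(\<lambda>k. v (Suc k)) ` {..<n} \<subseteq> ?W"
      by (force simp: image_subset_iff)
    have "v k \<in> ?W" for k
    proof (induction k)
      \<comment> \<open>For \<open>n = 0\<close> the membership of \<open>v 0\<close> is the
        assumption itself; otherwise \<open>v 0\<close> is one of the generators.\<close>
      case 0
      show ?case
        using n by (cases n) (auto intro: complex_vector.span_base)
    next
      case (Suc k)
      obtain y where "y \<in> cspan ((\<lambda>k. v (Suc k)) ` {..<n})" "(v k, y) \<in> A"
        using linear_operator_cspan_image[OF A step Suc] by blast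
      moreover have "y = v (Suc k)"
        using step[of k] \<open>(v k, y) \<in> A\<close> linear_operatorD(1)[OF A] by (auto simp: single_valued_def)
      ultimately show ?case
        using complex_vector.span_minimal[OF sub] by auto
    qed
    then have "cspan (range v) \<subseteq> ?W"
      by (intro complex_vector.span_minimal) auto
    then have "closure (cspan (range v)) \<subseteq> ?W"
      by (intro closure_minimal closed_cspan_finite) auto
    then have "?W = UNIV"
      using cyc by (auto simp: cyclic_vector_def v_def)
    then show False
      using inf by (auto simp: infinite_dimensional_def)
  qed
  then show "inj v" and "complex_vector.independent (range v)"
    by (rule independent_sequence)+
qed

lemma is_gram_schmidt_cspan:
  assumes "is_gram_schmidt v d"
  shows "cspan (range d) = cspan (range v)"
proof -
  have "d k \<in> cspan (v ` {..k})" "v k \<in> cspan (d ` {..k})" for k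
    using assms complex_vector.span_base[of "d k" "d ` {..k}"] complex_vector.span_base[of "v k" "v ` {..k}"]
    by (auto simp: is_gram_schmidt_def)
  then have "d k \<in> cspan (range v)" "v k \<in> cspan (range d)" for k
    using complex_vector.span_mono[of "v ` {..k}" "range v"] complex_vector.span_mono[of "d ` {..k}" "range d"]
    by blast+
  then show ?thesis
    by (auto simp: complex_vector.span_eq)
qed

section \<open>The density criterion\<close>

theorem proposition3p13:
  fixes A :: "('a::complex_hilbert \<times> 'a) set" and \<delta> :: 'a
  assumes separable: "separable_space (euclidean :: 'a topology)"
    and infinite_dim: "infinite_dimensional TYPE('a)"
    and selfadjoint: "selfadjoint A"
    and simple: "simple_operator A"
    and cyclic: "cyclic_vector A \<delta>"
  shows "basis_of_representation (gram_schmidt (\<lambda>k. op_apply (A ^^ k) \<delta>)) A \<longleftrightarrow>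
    closure (cspan (range (\<lambda>k. op_apply (op_minus_scalar A \<i>) (op_apply (A ^^ k) \<delta>)))) = UNIV"
proof -
  define v where "v k = op_apply (A ^^ k) \<delta>" for k
  define u where "u = gram_schmidt v"
  define w where "w k = v (Suc k) - \<i> *\<^sub>C v k" for k
  have clA: "closed_operator A"
    by (rule selfadjoint_closed[OF selfadjoint])
  then have linA: "linear_operator A"
    by (simp add: closed_operator_def)
  note sv = linear_operatorD(1)[OF linA]
  have v_eq: "v = (\<lambda>k. op_apply (A ^^ k) \<delta>)"
    by (simp add: v_def fun_eq_iff)
  have step: "(v k, v (Suc k)) \<in> A" for k
    unfolding v_def
    by (intro op_apply_relpow_Suc sv) (use cyclic in \<open>simp add: cyclic_vector_def\<close>)
  have w_eq: "w = (\<lambda>k. op_apply (op_minus_scalar A \<i>) (op_apply (A ^^ k) \<delta>))"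
    using op_apply_op_minus_scalar[OF sv step] by (simp add: w_def fun_eq_iff v_def)
  have gs: "is_gram_schmidt v u"
    unfolding u_def v_eq
    by (intro is_gram_schmidt_gram_schmidt cyclic_vector_independent infinite_dim linA cyclic)
  have span: "cspan (range u) = cspan (range v)"
    by (rule is_gram_schmidt_cspan[OF gs])
  have onb: "orthonormal_basis u"
    using gs cyclic by (auto simp: orthonormal_basis_def is_gram_schmidt_def span cyclic_vector_def v_eq)
  \<comment> \<open>The restriction of \<open>A\<close> to the span of the powers. Each direction
    passes through its graph: \<open>closure C\<close> serves as a competitor \<open>B\<close>, and
    later every competitor is shown to contain \<open>C\<close>.\<close>
  define C where "C = {(x, y) \<in> A. x \<in> cspan (range v)}"
  have C: "linear_operator C" "C \<subseteq> A"
    unfolding C_def by (auto intro: linear_operator_restrict linA)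
  have vC: "(v k, v (Suc k)) \<in> C" for k
    using step by (auto simp: C_def intro: complex_vector.span_base)
  have linM: "linear_operator (op_minus_scalar C \<i>)"
    by (rule linear_operator_op_minus_scalar[OF C(1)])
  have vM: "(v k, w k) \<in> op_minus_scalar C \<i>" for k
    using vC by (auto simp: op_minus_scalar_def w_def)
  have uC: "(u k, op_apply A (u k)) \<in> C" for k
  proof -
    have k: "u k \<in> cspan (range v)"
      unfolding span[symmetric] by (auto intro: complex_vector.span_base)
    then have "u k \<in> Domain A"
      using linear_operator_cspan_image[of A v "\<lambda>k. v (Suc k)", OF linA step] by blast
    then show ?thesis
      using k op_apply_in[OF sv] by (simp add: C_def)
  qed
  have "basis_of_representation u A \<longleftrightarrow> closure (cspan (range w)) = UNIV"
  proof
    assume basis: "basis_of_representation u A"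
    \<comment> \<open>The minimality condition is tested with \<open>B = closure C\<close>, a closed
      operator that agrees with \<open>A\<close> on every \<open>u k\<close>.\<close>
    have clC: "closed_operator (closure C)"
      by (rule closed_operator_closure[OF C clA])
    then have svC: "single_valued (closure C)"
      by (simp add: closed_operator_def linear_operator_def)
    have "(u k, op_apply A (u k)) \<in> closure C" for k
      using uC closure_subset by blast
    then have "u k \<in> Domain (closure C) \<and> op_apply (closure C) (u k) = op_apply A (u k)" for k
      using op_apply_eq[OF svC] by blast
    with basis clC have core: "A \<subseteq> closure C"
      unfolding basis_of_representation_def by blast
    show "closure (cspan (range w)) = UNIV"
    proof (rule ccontr)
      assume "\<not> ?thesis"
      then obtain y where y: "y \<noteq> 0" "\<And>t. t \<in> closure (cspan (range w)) \<Longrightarrow> cinner y t = 0"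
        by (rule nontrivial_orthogonal_vector[rotated 2])
          (simp_all add: subspace_closure)
      \<comment> \<open>Since \<open>A - \<i>\<close> sends \<open>v k\<close> to
        \<open>w k\<close>, it maps the span of \<open>v\<close> into the span of \<open>w\<close>,
        to which \<open>y\<close> is orthogonal.\<close>
      have "cinner y (b - \<i> *\<^sub>C a) = 0" if ab: "(a, b) \<in> C" for a b
      proof -
        have "a \<in> cspan (range v)"
          using ab by (simp add: C_def)
        then obtain t where t: "t \<in> cspan (range w)" "(a, t) \<in> op_minus_scalar C \<i>"
          using linear_operator_cspan_image[of _ v w, OF linM vM] by blast
        have "t = b - \<i> *\<^sub>C a"
          using t(2) ab linear_operatorD(1)[OF C(1)] by (auto simp: op_minus_scalar_def single_valued_def)
        then show ?thesis
          using t(1) y(2) closure_subset by blast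
      qed
      then have "y = 0"
        using selfadjoint_core_orthogonal[OF selfadjoint core] by blast
      with y show False
        by simp
    qed
  next
    assume dense: "closure (cspan (range w)) = UNIV"
    have preimage: "\<exists>x z. (x, z) \<in> C \<and> t = z - \<i> *\<^sub>C x" if "t \<in> cspan (range w)" for t
      using linear_operator_cspan_preimage[OF linM vM that] by (auto simp: op_minus_scalar_def)
    have "A \<subseteq> B" if B: "closed_operator B"
      and ext: "\<forall>k. u k \<in> Domain B \<and> op_apply B (u k) = op_apply A (u k)" for B
    proof clarify
      fix x y assume xy: "(x, y) \<in> A"
      have linB: "linear_operator B" and clB: "closed B"
        using B by (auto simp: closed_operator_def)
      have uB: "(u k, op_apply A (u k)) \<in> B" for k
        using op_apply_in[OF linear_operatorD(1)[OF linB]] ext by metis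
      have CB: "C \<subseteq> B"
        unfolding C_def span[symmetric]
        by (rule linear_operator_extends_on_cspan[OF linA linB _ uB]) (use uC C in blast)
      \<comment> \<open>To reach \<open>(x, y)\<close> from \<open>C\<close>, its image under
        \<open>A - \<i>\<close> is approximated first; each approximant is then lifted to a pair
        \<open>(p n, q n)\<close> in \<open>C\<close>.\<close>
      obtain t where t: "\<And>n. t n \<in> cspan (range w)" "t \<longlonglongrightarrow> y - \<i> *\<^sub>C x"
        using dense closure_sequential[of "y - \<i> *\<^sub>C x" "cspan (range w)"] by auto
      obtain p q where pq: "\<And>n. (p n, q n) \<in> C" "\<And>n. t n = q n - \<i> *\<^sub>C p n"
        using preimage[OF t(1)] by metis
      \<comment> \<open>The norm identity, applied to the difference of the two pairs, splits the
        error so that both components converge.\<close>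
      have pyth: "(norm (t n - (y - \<i> *\<^sub>C x)))\<^sup>2 = (norm (q n - y))\<^sup>2 + (norm (p n - x))\<^sup>2" for n
      proof -
        have "(p n - x, q n - y) \<in> A"
          using linear_operator_diff[OF linA _ xy] pq(1) C(2) by blast
        from norm_selfadjoint_minus_ii[OF selfadjoint this] show ?thesis
          by (simp add: pq(2) algebra_simps)
      qed
      have le: "norm (q n - y) \<le> norm (t n - (y - \<i> *\<^sub>C x))" "norm (p n - x) \<le> norm (t n - (y - \<i> *\<^sub>C x))" for n
        using pyth[of n] by (auto intro: power2_le_imp_le)
      have lim: "(\<lambda>n. norm (t n - (y - \<i> *\<^sub>C x))) \<longlonglongrightarrow> 0"
        using t(2) by (simp add: LIM_zero tendsto_norm_zero)
      have "p \<longlonglongrightarrow> x" "q \<longlonglongrightarrow> y"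
        by (rule LIM_zero_cancel, rule Lim_null_comparison[OF _ lim], simp add: le)+
      then have "(\<lambda>n. (p n, q n)) \<longlonglongrightarrow> (x, y)"
        by (rule tendsto_Pair)
      then show "(x, y) \<in> B"
        by (rule closed_sequentially[OF clB, rotated]) (use pq(1) CB in blast)
    qed
    moreover have "u k \<in> Domain A" for k
      using uC C(2) by blast
    ultimately show "basis_of_representation u A"
      using onb by (simp add: basis_of_representation_def)
  qed
  then show ?thesis
    by (simp add: u_def v_eq w_eq)
qed

end
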